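(* There exist $n\in\mathbb{N}$, $L>0$, a nonempty compact convex set $\mathcal{C}\subset\mathbb{R}^n$, an open convex set $\mathcal{D}\subset\mathbb{R}^n$ containing $\mathcal{C}$, a convex function $f\colon\mathcal{D}\to\mathbb{R}$ with $L$-Lipschitz-continuous gradient, and a point $x_0\in\mathcal{C}$ such that any sequence $(x_t)_{t\in\mathbb{N}}$ generated from $x_0$ by the Frank-Wolfe algorithm for minimizing $f$ over $\mathcal{C}$ using an open-loop step-size strategy, i.e., either of the two strategies $$\gamma_t=\frac{1}{t+1}\ \text{ for all }t\in\mathbb{N},\qquad\text{or}\qquad \gamma_t=\frac{2}{t+2}\ \text{ for all }t\in\mathbb{N},$$ does not converge.
   Context: $\mathbb{R}^n$ is equipped with the Euclidean inner product $\langle\cdot,\cdot\rangle$ and norm $\|\cdot\|$, and $\mathbb{N}=\{0,1,2,\ldots\}$. Given step sizes $(\gamma_t)_{t\in\mathbb{N}}\in[0,1]^{\mathbb{N}}$, a sequence $(x_t)_{t\in\mathbb{N}}$ is generated by the Frank-Wolfe algorithm for minimizing $f$ over $\mathcal{C}$ from $x_0\in\mathcal{C}$ if for all $t\in\mathbb{N}$ there exists $v_t\in\operatorname{arg\,min}_{v\in\mathcal{C}}\langle v,\nabla f(x_t)\rangle$ such that $x_{t+1}=(1-\gamma_t)x_t+\gamma_tv_t$. No restriction is made on which minimizer $v_t$ is selected: "any sequence" ranges over all possible choices of the $v_t$. *)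

theory Defs
  imports "HOL-Analysis.Analysis"
begin

text \<open>
  The dimension \<open>n\<close> is existentially quantified in the theorem, so it cannot be a type index as in
  \<open>real ^ 'n\<close>.  All spaces \<open>\<real>\<^sup>n\<close> are therefore realised inside one type: the finitely supported real
  sequences with the inner product \<open>\<Sum>i. x i * y i\<close>.  The sequences vanishing from index \<open>n\<close> on form a
  copy of \<open>\<real>\<^sup>n\<close> with its Euclidean inner product and norm (see \<open>inner_Rn\<close> and \<open>norm_Rn\<close> below), and
  convexity, compactness, derivatives and limits are those of the library.
\<close>

typedef fsvec = "{x :: nat \<Rightarrow> real. finite {i. x i \<noteq> 0}}"
  morphisms coord Abs_fsvec
  by (rule exI[of _ "\<lambda>_. 0"]) simp

setup_lifting type_definition_fsvec

lemma fsvec_eqI: "(\<And>i. coord x i = coord y i) \<Longrightarrow> x = y"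
  by (simp add: coord_inject[symmetric] fun_eq_iff)

lemma finite_coord: "finite {i. coord x i \<noteq> 0}"
  using coord[of x] by simp

instantiation fsvec :: real_vector
begin

lift_definition zero_fsvec :: fsvec is "\<lambda>_. 0" by simp

lift_definition plus_fsvec :: "fsvec \<Rightarrow> fsvec \<Rightarrow> fsvec" is "\<lambda>x y i. x i + y i"
  subgoal for x y
    by (rule finite_subset[of _ "{i. x i \<noteq> 0} \<union> {i. y i \<noteq> 0}"]) auto
  done

lift_definition minus_fsvec :: "fsvec \<Rightarrow> fsvec \<Rightarrow> fsvec" is "\<lambda>x y i. x i - y i"
  subgoal for x y
    by (rule finite_subset[of _ "{i. x i \<noteq> 0} \<union> {i. y i \<noteq> 0}"]) auto
  done

lift_definition uminus_fsvec :: "fsvec \<Rightarrow> fsvec" is "\<lambda>x i. - x i" by simp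

lift_definition scaleR_fsvec :: "real \<Rightarrow> fsvec \<Rightarrow> fsvec" is "\<lambda>r x i. r * x i"
  by (erule finite_subset[rotated]) auto

instance
  by standard
    (auto intro!: fsvec_eqI
      simp: zero_fsvec.rep_eq plus_fsvec.rep_eq minus_fsvec.rep_eq uminus_fsvec.rep_eq
        scaleR_fsvec.rep_eq algebra_simps)

end

lemmas coord_simps [simp] =
  zero_fsvec.rep_eq plus_fsvec.rep_eq minus_fsvec.rep_eq uminus_fsvec.rep_eq scaleR_fsvec.rep_eq

instantiation fsvec :: real_inner
begin

definition inner_fsvec :: "fsvec \<Rightarrow> fsvec \<Rightarrow> real"
  where "inner x y = (\<Sum>i | coord x i \<noteq> 0. coord x i * coord y i)"

definition norm_fsvec :: "fsvec \<Rightarrow> real"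
  where "norm x = sqrt (inner x (x :: fsvec))"

definition sgn_fsvec :: "fsvec \<Rightarrow> fsvec"
  where "sgn x = x /\<^sub>R norm (x :: fsvec)"

definition dist_fsvec :: "fsvec \<Rightarrow> fsvec \<Rightarrow> real"
  where "dist x y = norm (x - y :: fsvec)"

definition uniformity_fsvec :: "(fsvec \<times> fsvec) filter"
  where "uniformity_fsvec = (INF e\<in>{0<..}. principal {(x, y). dist x y < e})"

definition open_fsvec :: "fsvec set \<Rightarrow> bool"
  where "open_fsvec U \<longleftrightarrow> (\<forall>x\<in>U. \<forall>\<^sub>F (x', y) in uniformity. x' = x \<longrightarrow> y \<in> U)"

lemma inner_fsvec_superset:
  assumes "finite A" "{i. coord x i \<noteq> 0} \<subseteq> A"
  shows "inner x y = (\<Sum>i\<in>A. coord x i * coord y i)"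
  unfolding inner_fsvec_def by (rule sum.mono_neutral_left) (use assms in auto)

instance
proof
  fix x y z :: fsvec and r :: real
  let ?A = "{i. coord x i \<noteq> 0} \<union> {i. coord y i \<noteq> 0}"
  have fin: "finite ?A"
    by (simp add: finite_coord)
  have sup: "inner u v = (\<Sum>i\<in>?A. coord u i * coord v i)"
    if "\<And>i. coord x i = 0 \<Longrightarrow> coord y i = 0 \<Longrightarrow> coord u i = 0" for u v
    by (rule inner_fsvec_superset[OF fin]) (use that in auto)
  show "inner x y = inner y x"
    by (simp add: sup mult.commute)
  show "inner (x + y) z = inner x z + inner y z"
    by (simp add: sup sum.distrib distrib_right)
  show "inner (r *\<^sub>R x) y = r * inner x y"
    by (simp add: sup sum_distrib_left mult.assoc)
  show "0 \<le> inner x x"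
    unfolding inner_fsvec_def by (rule sum_nonneg) simp
  show "inner x x = 0 \<longleftrightarrow> x = 0"
  proof
    assume "inner x x = 0"
    then have "\<forall>i\<in>{i. coord x i \<noteq> 0}. coord x i * coord x i = 0"
      unfolding inner_fsvec_def by (subst (asm) sum_nonneg_eq_0_iff) (auto simp: finite_coord)
    then show "x = 0"
      by (intro fsvec_eqI) auto
  qed (simp add: inner_fsvec_def)
  show "norm x = sqrt (inner x x)"
    by (rule norm_fsvec_def)
  show "sgn x = x /\<^sub>R norm x"
    by (rule sgn_fsvec_def)
  show "dist x y = norm (x - y)"
    by (rule dist_fsvec_def)
  show "uniformity = (INF e\<in>{0<..}. principal {(x, y :: fsvec). dist x y < e})"
    by (rule uniformity_fsvec_def)
  show "open U \<longleftrightarrow> (\<forall>x\<in>U. \<forall>\<^sub>F (x', y) in uniformity. x' = x \<longrightarrow> y \<in> U)" for U :: "fsvec set"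
    by (rule open_fsvec_def)
qed

end

definition Rn :: "nat \<Rightarrow> fsvec set"
  where "Rn n = {x. \<forall>i\<ge>n. coord x i = 0}"

lemma bij_betw_coord_Rn: "bij_betw coord (Rn n) {x. \<forall>i\<ge>n. x i = 0}"
proof (rule bij_betw_byWitness[of _ Abs_fsvec])
  have *: "coord (Abs_fsvec x) = x" if "\<forall>i\<ge>n. x i = 0" for x
    by (rule Abs_fsvec_inverse)
      (use that in \<open>auto intro!: finite_subset[of _ "{..<n}"] simp: not_le[symmetric]\<close>)
  then show "\<forall>x\<in>{x. \<forall>i\<ge>n. x i = 0}. coord (Abs_fsvec x) = x"
    by blast
  show "Abs_fsvec ` {x. \<forall>i\<ge>n. x i = 0} \<subseteq> Rn n"
    using * by (auto simp: Rn_def)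
qed (auto simp: coord_inverse Rn_def)

lemma subspace_Rn: "subspace (Rn n)"
  by (simp add: subspace_def Rn_def)

lemma inner_Rn:
  assumes "x \<in> Rn n"
  shows "inner x y = (\<Sum>i<n. coord x i * coord y i)"
  by (rule inner_fsvec_superset) (use assms in \<open>auto simp: Rn_def not_le[symmetric]\<close>)

lemma norm_Rn: "x \<in> Rn n \<Longrightarrow> norm x = sqrt (\<Sum>i<n. (coord x i)\<^sup>2)"
  by (simp add: norm_eq_sqrt_inner inner_Rn power2_eq_square)

lemma abs_coord_le_norm: "\<bar>coord x i\<bar> \<le> norm x"
proof (cases "coord x i = 0")
  case False
  have "(coord x i)\<^sup>2 \<le> (\<Sum>j | coord x j \<noteq> 0. (coord x j)\<^sup>2)"
    by (rule member_le_sum) (use False in \<open>auto simp: finite_coord\<close>)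
  then have "sqrt ((coord x i)\<^sup>2) \<le> norm x"
    unfolding norm_eq_sqrt_inner inner_fsvec_def
    by (simp only: real_sqrt_le_iff power2_eq_square)
  then show ?thesis by simp
qed simp

lemma bounded_linear_coord: "bounded_linear (\<lambda>x. coord x i)"
  by (rule bounded_linear_intro[where K = 1]) (simp_all add: abs_coord_le_norm)

text \<open>Hence a sequence in \<open>Rn n\<close> that converges at all converges in \<open>Rn n\<close>.\<close>

lemma closed_Rn: "closed (Rn n)"
proof -
  have "closed {x. coord x i = 0}" for i
    by (rule closed_Collect_eq)
      (auto intro: linear_continuous_on[OF bounded_linear_coord])
  then have "closed (\<Inter>i\<in>{n..}. {x. coord x i = 0})"
    by blast
  moreover have "Rn n = (\<Inter>i\<in>{n..}. {x. coord x i = 0})"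
    by (auto simp: Rn_def)
  ultimately show ?thesis by simp
qed

text \<open>
  Library \<open>GDERIV\<close>, but for functions on the subspace \<open>Rn n\<close>: increments are restricted to \<open>Rn n\<close>.
  At points of a relatively open \<open>D \<subseteq> Rn n\<close>, only the values of \<open>f\<close> on \<open>D\<close> matter.
\<close>

definition has_gradient :: "nat \<Rightarrow> (fsvec \<Rightarrow> real) \<Rightarrow> fsvec \<Rightarrow> fsvec \<Rightarrow> bool"
  where "has_gradient n f x g \<longleftrightarrow>
    g \<in> Rn n \<and> (f has_derivative (\<lambda>h. inner h g)) (at x within Rn n)"

definition grad :: "nat \<Rightarrow> (fsvec \<Rightarrow> real) \<Rightarrow> fsvec \<Rightarrow> fsvec"
  where "grad n f x = (THE g. has_gradient n f x g)"

lemma has_gradient_unique: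
  assumes "x \<in> Rn n" "has_gradient n f x g" "has_gradient n f x g'"
  shows "g = g'"
proof -
  define h where "h = g - g'"
  have h: "h \<in> Rn n"
    using assms subspace_Rn by (auto simp: h_def has_gradient_def intro: subspace_diff)
  have line: "(\<lambda>t. x + t *\<^sub>R h) ` UNIV \<subseteq> Rn n"
    using assms(1) h subspace_Rn by (auto intro: subspace_add subspace_scale)
  have "((\<lambda>t::real. f (x + t *\<^sub>R h)) has_real_derivative inner h k) (at 0)"
    if "has_gradient n f x k" for k
  proof -
    have "((\<lambda>t::real. x + t *\<^sub>R h) has_derivative (\<lambda>t. t *\<^sub>R h)) (at 0)"
      by (auto intro!: derivative_eq_intros)
    moreover have "(f has_derivative (\<lambda>h. inner h k))
        (at (x + 0 *\<^sub>R h) within range (\<lambda>t::real. x + t *\<^sub>R h))"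
      using that line by (auto simp: has_gradient_def intro: has_derivative_subset)
    ultimately have "((\<lambda>t::real. f (x + t *\<^sub>R h)) has_derivative (\<lambda>t. inner (t *\<^sub>R h) k)) (at 0)"
      by (rule has_derivative_in_compose)
    then show ?thesis
      by (rule has_derivative_imp_has_field_derivative) (simp add: mult.commute)
  qed
  with assms have "inner h g = inner h g'"
    by (blast intro: DERIV_unique)
  then have "inner h h = 0"
    by (simp add: h_def inner_diff_right)
  then show ?thesis
    by (simp add: h_def)
qed

lemma grad_eq: "x \<in> Rn n \<Longrightarrow> has_gradient n f x g \<Longrightarrow> grad n f x = g"
  unfolding grad_def by (blast intro: has_gradient_unique)

definition frank_wolfe ::
  "nat \<Rightarrow> fsvec set \<Rightarrow> (fsvec \<Rightarrow> real) \<Rightarrow> (nat \<Rightarrow> real) \<Rightarrow> fsvec \<Rightarrow> (nat \<Rightarrow> fsvec) \<Rightarrow> bool"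
  where "frank_wolfe n C f \<gamma> x0 x \<longleftrightarrow>
    (\<forall>t. \<gamma> t \<in> {0..1}) \<and> x0 \<in> C \<and> x 0 = x0 \<and>
    (\<forall>t. \<exists>v. is_arg_min (\<lambda>w. inner w (grad n f (x t))) (\<lambda>w. w \<in> C) v \<and>
      x (Suc t) = (1 - \<gamma> t) *\<^sub>R x t + \<gamma> t *\<^sub>R v)"

end

theory Submission
  imports Defs
begin

text \<open>
  The counterexample lives in the plane. Write points as \<open>(a, b)\<close>. The feasible set is the trapezoid
  with corners \<open>(-1, 0)\<close>, \<open>(1, 0)\<close>, \<open>(2, 1)\<close>, \<open>(-2, 1)\<close>, the start is \<open>(-2, 1)\<close>, and the objective is
  \<open>b / 2\<close> plus a weighted sum of squares of the positive parts of
  \<open>slope j * b - 1 - (-1) ^ j * a\<close>, where the slopes are \<open>0, 32, 32\<^sup>2, \<dots>\<close>.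

  Wherever \<open>a \<ge> -1\<close>, the gradient points upwards, more steeply than sideways
  (\<open>gradient_mostly_vertical\<close>). There the linear minimization oracle returns a point of the base
  \<open>b = 0\<close>, so the heights \<open>b\<^sub>t\<close> of the iterates are multiplied by \<open>1 - \<gamma>\<^sub>t\<close>: they tend to \<open>0\<close> without ever
  reaching it. Reaching it would be fatal, since on the base the gradient is vertical: every base
  point would be an admissible answer, and the iterates could stay where they are. Both step-size
  rules have \<open>\<gamma>\<^sub>0 = 1\<close>, which replaces the start by the first oracle answer; the term \<open>j = 0\<close> only serves to
  make this answer the corner \<open>(2, 1)\<close> (\<open>gradient_at_start\<close>).

  The remaining terms are active above ever flatter lines, which rise from the two ends of the base
  alternately and push towards the other end. At a height comparable with \<open>1 / 32 ^ k\<close>, and away from the end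
  \<open>(-1) ^ k\<close> of the base, the horizontal slope is governed by the \<open>k\<close>-th term and directs the oracle to the
  vertex \<open>((-1) ^ k, 0)\<close> (\<open>gradient_window\<close>): earlier terms with the opposite push vanish, and later ones
  carry too little weight. While the oracle returns one and the same vertex, the iterates move on a
  straight line towards it, so when the height is halved, so is the horizontal distance to that
  vertex. Were \<open>a\<^sub>t\<close> to converge, one of the two ends of the base would be at distance at least \<open>1\<close> from the
  limit, and for arbitrarily large \<open>k\<close> of the corresponding parity the distance to that end would
  be halved, which is impossible (\<open>pushed_averages_oscillate\<close>).
\<close>

section \<open>The coordinate plane\<close>

definition plane :: "real \<Rightarrow> real \<Rightarrow> fsvec"
  where "plane a b = Abs_fsvec (\<lambda>i. if i = 0 then a else if i = 1 then b else 0)"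

lemma coord_plane: "coord (plane a b) i = (if i = 0 then a else if i = 1 then b else 0)"
proof -
  have "finite {i::nat. (if i = 0 then a else if i = 1 then b else 0) \<noteq> 0}"
    by (rule finite_subset[of _ "{0, 1}"]) (auto split: if_splits)
  then have "(\<lambda>i::nat. if i = 0 then a else if i = 1 then b else 0) \<in> {x. finite {i. x i \<noteq> 0}}"
    unfolding mem_Collect_eq .
  then show ?thesis
    by (simp only: plane_def Abs_fsvec_inverse)
qed

lemma plane_in_Rn: "plane a b \<in> Rn 2"
  by (simp add: Rn_def coord_plane)

lemma plane_coord: "z \<in> Rn 2 \<Longrightarrow> plane (coord z 0) (coord z 1) = z"
  by (rule fsvec_eqI) (auto simp: Rn_def coord_plane)

lemma inner_plane: "inner z (plane a b) = coord z 0 * a + coord z 1 * b"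
proof -
  have "inner (plane a b) z = a * coord z 0 + b * coord z 1"
    using inner_Rn[OF plane_in_Rn] by (simp add: coord_plane numeral_2_eq_2)
  then show ?thesis
    by (simp add: inner_commute mult.commute)
qed

lemma norm_plane_le: "norm (plane a b) \<le> \<bar>a\<bar> + \<bar>b\<bar>"
  using norm_Rn[OF plane_in_Rn] sqrt_sum_squares_le_sum_abs
  by (simp add: coord_plane numeral_2_eq_2)

lemma plane_diff: "plane a b - plane c d = plane (a - c) (b - d)"
  by (rule fsvec_eqI) (simp add: coord_plane)

lemma bounded_linear_plane: "bounded_linear (\<lambda>p. plane (fst p) (snd p))"
proof (rule bounded_linear_intro[where K = 2])
  show "norm (plane (fst p) (snd p)) \<le> norm p * 2" for p
    using norm_plane_le[of "fst p" "snd p"] norm_fst_le[of "fst p" "snd p"]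
      norm_snd_le[of "snd p" "fst p"] by simp
qed (auto intro!: fsvec_eqI simp: coord_plane)

section \<open>A smooth convex sum of squared hinges\<close>

text \<open>
  Both inequalities are preserved by summing, so a series can be differentiated by bounding its terms:
  the lower one is the supporting hyperplane characterisation of convexity, and together they leave
  a remainder of second order.
\<close>

lemma gradient_from_quadratic_bounds:
  assumes g: "\<And>x. x \<in> Rn n \<Longrightarrow> g x \<in> Rn n"
    and lower: "\<And>x y. \<lbrakk>x \<in> Rn n; y \<in> Rn n\<rbrakk> \<Longrightarrow> f x + inner (y - x) (g x) \<le> f y"
    and upper: "\<And>x y. \<lbrakk>x \<in> Rn n; y \<in> Rn n\<rbrakk> \<Longrightarrow>
        f y \<le> f x + inner (y - x) (g x) + K * (norm (y - x))\<^sup>2"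
  shows "convex_on (Rn n) f" and "x \<in> Rn n \<Longrightarrow> has_gradient n f x (g x)"
proof -
  show "convex_on (Rn n) f"
  proof (rule convex_onI)
    fix u x y assume u: "0 < u" "u < (1::real)" and xy: "x \<in> Rn n" "y \<in> Rn n"
    define z where "z = (1 - u) *\<^sub>R x + u *\<^sub>R y"
    have z: "z \<in> Rn n"
      unfolding z_def using xy subspace_Rn by (intro subspace_add subspace_scale)
    have "(1 - u) * inner (x - z) (g z) + u * inner (y - z) (g z)
        = inner ((1 - u) *\<^sub>R (x - z) + u *\<^sub>R (y - z)) (g z)"
      by (simp add: inner_add_left)
    also have "(1 - u) *\<^sub>R (x - z) + u *\<^sub>R (y - z) = 0"
      by (simp add: z_def algebra_simps flip: scaleR_add_left)
    finally have "f z = (1 - u) * (f z + inner (x - z) (g z)) + u * (f z + inner (y - z) (g z))"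
      by (simp add: algebra_simps)
    also have "\<dots> \<le> (1 - u) * f x + u * f y"
      using u lower[OF z xy(1)] lower[OF z xy(2)] by (intro add_mono mult_left_mono) auto
    finally show "f ((1 - u) *\<^sub>R x + u *\<^sub>R y) \<le> (1 - u) * f x + u * f y"
      by (simp add: z_def)
  qed (simp add: subspace_imp_convex subspace_Rn)
  show "has_gradient n f x (g x)" if x: "x \<in> Rn n"
    unfolding has_gradient_def
  proof (intro conjI g x)
    show "(f has_derivative (\<lambda>h. inner h (g x))) (at x within Rn n)"
    proof (rule has_derivativeI_sandwich[where e = 1 and H = "\<lambda>y. K * norm (y - x)"])
      show "bounded_linear (\<lambda>h. inner h (g x))"
        by (rule bounded_linear_inner_left)
      have "((\<lambda>y. K * norm (y - x)) \<longlongrightarrow> K * norm (x - x)) (at x within Rn n)"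
        by (intro tendsto_intros)
      then show "((\<lambda>y. K * norm (y - x)) \<longlongrightarrow> 0) (at x within Rn n)"
        by simp
    next
      fix y assume "y \<in> Rn n" "y \<noteq> x" "dist y x < 1"
      then have "norm (f y - f x - inner (y - x) (g x)) \<le> K * norm (y - x) * norm (y - x)"
        using lower[OF x] upper[OF x] by (force simp: power2_eq_square mult.assoc)
      then show "norm (f y - f x - inner (y - x) (g x)) / norm (y - x) \<le> K * norm (y - x)"
        using \<open>y \<noteq> x\<close> by (simp add: divide_le_eq)
    qed simp
  qed
qed

text \<open>
  The slope at \<open>j = 0\<close> is \<open>0\<close> instead of \<open>1\<close>: the hinge of index \<open>0\<close> is then active on the half-plane \<open>a < -1\<close>, which
  contains the start and none of the later iterates. The weights decrease like the inverse cubes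
  of the slopes: the smoothness constants \<open>weight j * (slope j)\<^sup>2\<close> are summable, and
  \<open>weight j * slope j\<close> decreases fast enough for one horizontal slope to dominate all later ones.
\<close>

definition slope :: "nat \<Rightarrow> real"
  where "slope j = (if j = 0 then 0 else 32 ^ j)"

definition weight :: "nat \<Rightarrow> real"
  where "weight j = (1 / 32) ^ (3 * j)"

definition hinge :: "nat \<Rightarrow> real \<Rightarrow> real \<Rightarrow> real"
  where "hinge j a b = max 0 (slope j * b - 1 - (-1) ^ j * a)"

definition obj :: "real \<Rightarrow> real \<Rightarrow> real"
  where "obj a b = b / 2 + (\<Sum>j. weight j * (hinge j a b)\<^sup>2 / 2)"

text \<open>The two partial derivatives of \<open>obj\<close>, obtained term by term.\<close>

definition obj_a :: "real \<Rightarrow> real \<Rightarrow> real"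
  where "obj_a a b = (\<Sum>j. weight j * (- ((-1) ^ j) * hinge j a b))"

definition obj_b :: "real \<Rightarrow> real \<Rightarrow> real"
  where "obj_b a b = 1 / 2 + (\<Sum>j. weight j * (slope j * hinge j a b))"

text \<open>Up to a constant, the smoothness modulus of the \<open>j\<close>-th term; it dominates every series below.\<close>

definition mass :: "nat \<Rightarrow> real"
  where "mass j = weight j * (slope j + 1)\<^sup>2"

lemma slope_nonneg: "0 \<le> slope j"
  by (simp add: slope_def)

lemma weight_pos: "0 < weight j"
  by (simp add: weight_def)

lemma hinge_nonneg: "0 \<le> hinge j a b"
  by (simp add: hinge_def)

lemma alternating_cases: obtains "(-1::real) ^ j = 1" | "(-1::real) ^ j = -1"
  using minus_one_power_iff by metis

lemma weight_slope: "0 < j \<Longrightarrow> weight j * slope j = (1 / 32) ^ (2 * j)"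
  "0 < j \<Longrightarrow> weight j * (slope j)\<^sup>2 = (1 / 32) ^ j"
  by (simp_all add: weight_def slope_def power_divide divide_simps flip: power_mult power_add)

lemma summable_mass: "summable mass"
proof (rule summable_comparison_test')
  show "summable (\<lambda>j. 4 * (1 / 32 :: real) ^ j)"
    by (intro summable_mult summable_geometric) simp
  fix j :: nat assume "0 \<le> j"
  show "norm (mass j) \<le> 4 * (1 / 32) ^ j"
  proof (cases "j = 0")
    case False
    then have "1 \<le> slope j"
      by (simp add: slope_def)
    then have "(slope j + 1)\<^sup>2 \<le> (2 * slope j)\<^sup>2"
      by (intro power_mono) auto
    then have "mass j \<le> weight j * (2 * slope j)\<^sup>2"
      unfolding mass_def using weight_pos[of j] by (intro mult_left_mono) auto
    also have "\<dots> = 4 * (weight j * (slope j)\<^sup>2)"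
      by (simp add: power2_eq_square)
    finally show ?thesis
      using False weight_pos[of j] by (simp add: weight_slope mass_def)
  qed (simp add: mass_def weight_def slope_def)
qed

lemma suminf_mass_pos: "0 < suminf mass"
  by (rule suminf_pos2[OF summable_mass, of 0])
    (auto simp: mass_def weight_def slope_def)

lemma mass_bounds:
  assumes "0 \<le> p" "p \<le> slope j + 1"
  shows "weight j * p \<le> mass j" "weight j * (slope j * p) \<le> mass j" "weight j * p\<^sup>2 \<le> mass j"
proof -
  have s: "0 \<le> slope j" "0 \<le> weight j"
    using slope_nonneg[of j] weight_pos[of j] by auto
  have "p * 1 \<le> (slope j + 1) * (slope j + 1)" "slope j * p \<le> (slope j + 1) * (slope j + 1)"
    "p * p \<le> (slope j + 1) * (slope j + 1)"
    by (intro mult_mono; use assms s in simp)+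
  then show "weight j * p \<le> mass j" "weight j * (slope j * p) \<le> mass j" "weight j * p\<^sup>2 \<le> mass j"
    unfolding mass_def power2_eq_square by (auto intro!: mult_left_mono s)
qed

lemma hinge_lipschitz:
  "\<bar>hinge j a b - hinge j c d\<bar> \<le> slope j * \<bar>b - d\<bar> + \<bar>a - c\<bar>"
proof -
  have "slope j * \<bar>b - d\<bar> = \<bar>slope j * b - slope j * d\<bar>"
    using slope_nonneg[of j] by (simp add: abs_mult flip: right_diff_distrib)
  then show ?thesis
    by (cases j rule: alternating_cases) (auto simp: hinge_def)
qed

lemma hinge_lipschitz_max:
  assumes "\<bar>a - c\<bar> \<le> r" "\<bar>b - d\<bar> \<le> r"
  shows "\<bar>hinge j a b - hinge j c d\<bar> \<le> (slope j + 1) * r"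
  using hinge_lipschitz[of j a b c d] mult_left_mono[OF assms(2) slope_nonneg[of j]] assms(1)
  by (simp add: algebra_simps)

lemma hinge_bound:
  "hinge j a b \<le> (slope j + 1) * (1 + \<bar>a\<bar> + \<bar>b\<bar>)"
proof -
  have "hinge j 0 0 = 0"
    by (simp add: hinge_def)
  then have "hinge j a b \<le> slope j * \<bar>b\<bar> + \<bar>a\<bar>"
    using hinge_lipschitz[of j a b 0 0] by simp
  also have "\<dots> \<le> (slope j + 1) * (1 + \<bar>a\<bar> + \<bar>b\<bar>)"
    using slope_nonneg[of j] by (simp add: algebra_simps)
  finally show ?thesis .
qed

lemma summable_dominated_by_mass:
  fixes u :: "nat \<Rightarrow> real"
  assumes "\<And>j. \<bar>u j\<bar> \<le> mass j * K"
  shows "summable u"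
  by (rule summable_comparison_test'[OF summable_mult2[OF summable_mass]]) (use assms in auto)

lemma summable_obj:
  "summable (\<lambda>j. weight j * (hinge j a b)\<^sup>2 / 2)"
  "summable (\<lambda>j. weight j * (- ((-1) ^ j) * hinge j a b))"
  "summable (\<lambda>j. weight j * (slope j * hinge j a b))"
proof -
  define R where "R = 1 + \<bar>a\<bar> + \<bar>b\<bar>"
  have R: "0 < R"
    by (simp add: R_def add_pos_nonneg)
  have p: "0 \<le> hinge j a b / R" "hinge j a b / R \<le> slope j + 1" for j
    using hinge_nonneg[of j a b] hinge_bound[of j a b] R
    by (auto simp: R_def[symmetric] divide_le_eq)
  note m = mass_bounds[OF p]
  have nn: "0 \<le> weight j * (slope j * hinge j a b)" "0 \<le> weight j * hinge j a b" for j
    using weight_pos[of j] slope_nonneg[of j] hinge_nonneg[of j a b] by simp_all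
  show "summable (\<lambda>j. weight j * (hinge j a b)\<^sup>2 / 2)"
  proof (rule summable_dominated_by_mass[where K = "R\<^sup>2"])
    fix j
    have "weight j * (hinge j a b)\<^sup>2 \<le> mass j * R\<^sup>2"
      using m(3)[of j] R by (simp add: power_divide divide_simps)
    moreover have "0 \<le> weight j * (hinge j a b)\<^sup>2"
      using weight_pos[of j] by simp
    ultimately show "\<bar>weight j * (hinge j a b)\<^sup>2 / 2\<bar> \<le> mass j * R\<^sup>2"
      by linarith
  qed
  show "summable (\<lambda>j. weight j * (- ((-1) ^ j) * hinge j a b))"
  proof (rule summable_dominated_by_mass[where K = R])
    show "\<bar>weight j * (- ((-1) ^ j) * hinge j a b)\<bar> \<le> mass j * R" for j
      using m(1)[of j] nn(2)[of j] R weight_pos[of j] hinge_nonneg[of j a b]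
      by (simp add: abs_mult power_abs divide_simps)
  qed
  show "summable (\<lambda>j. weight j * (slope j * hinge j a b))"
  proof (rule summable_dominated_by_mass[where K = R])
    show "\<bar>weight j * (slope j * hinge j a b)\<bar> \<le> mass j * R" for j
      using m(2)[of j] nn(1)[of j] R by (simp add: abs_of_nonneg divide_simps)
  qed
qed

text \<open>
  The function \<open>u \<mapsto> (max 0 u)\<^sup>2 / 2\<close> is convex, with the 1-Lipschitz derivative \<open>max 0 u\<close>.
\<close>

lemma half_square_pos_part:
  fixes u v :: real
  shows "max 0 u * (v - u) \<le> (max 0 v)\<^sup>2 / 2 - (max 0 u)\<^sup>2 / 2"
    and "(max 0 v)\<^sup>2 / 2 - (max 0 u)\<^sup>2 / 2 \<le> max 0 u * (v - u) + (v - u)\<^sup>2 / 2"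
proof -
  have expand: "(v - u)\<^sup>2 = v * v - 2 * (u * v) + u * u" "u * (v - u) = u * v - u * u"
    "u\<^sup>2 = u * u" "v\<^sup>2 = v * v"
    by (simp_all add: power2_eq_square algebra_simps)
  have sq: "0 \<le> u * u" "0 \<le> v * v"
    by simp_all
  have sq': "0 \<le> v * v - 2 * (u * v) + u * u"
    using zero_le_power2[of "v - u"] by (simp only: expand(1))
  have opp: "u * v \<le> 0" if "u \<le> 0 \<and> 0 \<le> v \<or> 0 \<le> u \<and> v \<le> 0"
    using that by (auto simp: mult_le_0_iff)
  consider "0 \<le> u" "0 \<le> v" | "0 \<le> u" "v \<le> 0" | "u \<le> 0" "0 \<le> v" | "u \<le> 0" "v \<le> 0"
    by linarith
  then have "max 0 u * (v - u) \<le> (max 0 v)\<^sup>2 / 2 - (max 0 u)\<^sup>2 / 2 \<and>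
    (max 0 v)\<^sup>2 / 2 - (max 0 u)\<^sup>2 / 2 \<le> max 0 u * (v - u) + (v - u)\<^sup>2 / 2"
  proof cases
    case 1
    have "r - p \<le> q / 2 - p / 2 \<and> q / 2 - p / 2 \<le> r - p + (q - 2 * r + p) / 2"
      if "0 \<le> q - 2 * r + p" for p q r :: real
      using that by (simp add: field_simps)
    from this[OF sq'] 1 show ?thesis
      by (simp only: max_absorb2 expand)
  next
    case 2
    have "r - p \<le> 0\<^sup>2 / 2 - p / 2 \<and> 0\<^sup>2 / 2 - p / 2 \<le> r - p + (q - 2 * r + p) / 2"
      if "0 \<le> p" "0 \<le> q" "r \<le> 0" for p q r :: real
      using that by (simp add: field_simps)
    from this[OF sq opp] 2 show ?thesis
      by (simp only: max_absorb1 max_absorb2 expand simp_thms)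
  next
    case 3
    have "0 * x \<le> q / 2 - 0\<^sup>2 / 2 \<and> q / 2 - 0\<^sup>2 / 2 \<le> 0 * x + (q - 2 * r + p) / 2"
      if "0 \<le> p" "0 \<le> q" "r \<le> 0" for p q r x :: real
      using that by (simp add: field_simps)
    from this[OF sq opp] 3 show ?thesis
      by (simp only: max_absorb1 max_absorb2 expand simp_thms)
  next
    case 4
    then show ?thesis
      by (simp add: max_absorb1)
  qed
  then show "max 0 u * (v - u) \<le> (max 0 v)\<^sup>2 / 2 - (max 0 u)\<^sup>2 / 2"
    "(max 0 v)\<^sup>2 / 2 - (max 0 u)\<^sup>2 / 2 \<le> max 0 u * (v - u) + (v - u)\<^sup>2 / 2"
    by simp_all
qed

text \<open>
  The terms of \<open>obj\<close> are \<open>(max 0 u)\<^sup>2 / 2\<close> composed with affine functions, so the bounds for the latter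
  can be summed. The radius \<open>r\<close> bounds both increments in place of the norm.
\<close>

lemma obj_bounds:
  fixes a b c d :: real
  defines "lin \<equiv> (c - a) * obj_a a b + (d - b) * obj_b a b"
  shows "obj a b + lin \<le> obj c d"
    and "\<lbrakk>\<bar>c - a\<bar> \<le> r; \<bar>d - b\<bar> \<le> r\<rbrakk> \<Longrightarrow> obj c d \<le> obj a b + lin + suminf mass * r\<^sup>2"
proof -
  define lin_term where "lin_term j = (c - a) * (weight j * (- ((-1) ^ j) * hinge j a b))
      + (d - b) * (weight j * (slope j * hinge j a b))" for j
  define dif where "dif j = weight j * (hinge j c d)\<^sup>2 / 2 - weight j * (hinge j a b)\<^sup>2 / 2" for j
  have lin_sum: "summable lin_term" "suminf lin_term + (d - b) / 2 = lin"
  proof -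
    have "lin_term sums ((c - a) * obj_a a b + (d - b) * (obj_b a b - 1 / 2))"
      unfolding lin_term_def obj_a_def obj_b_def add_diff_cancel_left'
      by (intro sums_add sums_mult summable_sums summable_obj)
    then show "summable lin_term" "suminf lin_term + (d - b) / 2 = lin"
      by (simp_all add: sums_iff lin_def algebra_simps)
  qed
  have dif_sum: "summable dif" "suminf dif + (d - b) / 2 = obj c d - obj a b"
  proof -
    have "dif sums ((obj c d - d / 2) - (obj a b - b / 2))"
      unfolding dif_def obj_def add_diff_cancel_left'
      by (intro sums_diff summable_sums summable_obj)
    then show "summable dif" "suminf dif + (d - b) / 2 = obj c d - obj a b"
      by (simp_all add: sums_iff field_simps)
  qed
  define u where "u j = slope j * b - 1 - (-1) ^ j * a" for j
  define v where "v j = slope j * d - 1 - (-1) ^ j * c" for j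
  have lin_eq: "lin_term j = weight j * (max 0 (u j) * (v j - u j))" for j
    by (simp add: lin_term_def u_def v_def hinge_def algebra_simps)
  have dif_eq: "dif j = weight j * ((max 0 (v j))\<^sup>2 / 2 - (max 0 (u j))\<^sup>2 / 2)" for j
    by (simp add: dif_def u_def v_def hinge_def algebra_simps)
  have "lin_term j \<le> dif j" for j
    unfolding lin_eq dif_eq
    using half_square_pos_part(1) weight_pos[of j] by (intro mult_left_mono) auto
  then have "suminf lin_term \<le> suminf dif"
    by (intro suminf_le lin_sum dif_sum)
  then show "obj a b + lin \<le> obj c d"
    using lin_sum dif_sum by simp
  assume r: "\<bar>c - a\<bar> \<le> r" "\<bar>d - b\<bar> \<le> r"
  have "dif j \<le> lin_term j + mass j * r\<^sup>2" for j
  proof -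
    have "\<bar>v j - u j\<bar> = \<bar>slope j * (d - b) - (-1) ^ j * (c - a)\<bar>"
      by (simp add: u_def v_def algebra_simps)
    also have "\<dots> \<le> \<bar>slope j * (d - b)\<bar> + \<bar>(-1) ^ j * (c - a)\<bar>"
      by (rule abs_triangle_ineq4)
    also have "\<dots> \<le> slope j * r + r"
      using r mult_left_mono[OF r(2) slope_nonneg[of j]] slope_nonneg[of j]
      by (simp add: abs_mult power_abs)
    finally have "\<bar>v j - u j\<bar>\<^sup>2 \<le> ((slope j + 1) * r)\<^sup>2"
      by (intro power_mono) (auto simp: algebra_simps)
    then have "(v j - u j)\<^sup>2 / 2 \<le> (slope j + 1)\<^sup>2 * r\<^sup>2"
      using zero_le_power2[of "v j - u j"] unfolding power_mult_distrib power2_abs by linarith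
    then have "dif j \<le> weight j * (max 0 (u j) * (v j - u j) + (slope j + 1)\<^sup>2 * r\<^sup>2)"
      unfolding dif_eq
      using half_square_pos_part(2)[of "v j" "u j"] weight_pos[of j]
      by (intro mult_left_mono) auto
    then show ?thesis
      by (simp add: lin_eq mass_def algebra_simps)
  qed
  then have "suminf dif \<le> (\<Sum>j. lin_term j + mass j * r\<^sup>2)"
    by (intro suminf_le summable_add summable_mult2 lin_sum dif_sum summable_mass)
  also have "\<dots> = suminf lin_term + suminf mass * r\<^sup>2"
    by (simp add: suminf_add[symmetric] lin_sum summable_mult2 summable_mass suminf_mult2)
  finally show "obj c d \<le> obj a b + lin + suminf mass * r\<^sup>2"
    using lin_sum dif_sum by simp
qed

lemma gradient_lipschitz:
  assumes "\<bar>a - c\<bar> \<le> r" "\<bar>b - d\<bar> \<le> r"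
  shows "\<bar>obj_a a b - obj_a c d\<bar> \<le> suminf mass * r"
    and "\<bar>obj_b a b - obj_b c d\<bar> \<le> suminf mass * r"
proof -
  have r: "0 \<le> r"
    using assms(1) by simp
  have est: "weight j * \<bar>hinge j a b - hinge j c d\<bar> \<le> mass j * r"
    "weight j * (slope j * \<bar>hinge j a b - hinge j c d\<bar>) \<le> mass j * r" for j
  proof -
    have w: "\<bar>hinge j a b - hinge j c d\<bar> \<le> (slope j + 1) * r"
      by (rule hinge_lipschitz_max[OF assms])
    have s: "0 \<le> weight j" "0 \<le> slope j"
      using slope_nonneg[of j] weight_pos[of j] by auto
    have "weight j * \<bar>hinge j a b - hinge j c d\<bar> \<le> weight j * ((slope j + 1) * r)"
      by (intro mult_left_mono w s)
    also have "\<dots> \<le> mass j * r"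
      using mult_right_mono[OF mass_bounds(1)[of "slope j + 1" j] r] s by (simp add: mult.assoc)
    finally show "weight j * \<bar>hinge j a b - hinge j c d\<bar> \<le> mass j * r" .
    have "weight j * (slope j * \<bar>hinge j a b - hinge j c d\<bar>)
        \<le> weight j * (slope j * ((slope j + 1) * r))"
      by (intro mult_left_mono w s)
    also have "\<dots> \<le> mass j * r"
      using mult_right_mono[OF mass_bounds(2)[of "slope j + 1" j] r] s by (simp add: mult.assoc)
    finally show "weight j * (slope j * \<bar>hinge j a b - hinge j c d\<bar>) \<le> mass j * r" .
  qed
  have sums: "\<bar>suminf p - suminf p'\<bar> \<le> suminf mass * r"
    if "summable p" "summable p'" "\<And>j. \<bar>p j - p' j\<bar> \<le> mass j * r" for p p' :: "nat \<Rightarrow> real"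
  proof -
    have "suminf p - suminf p' = (\<Sum>j. p j - p' j)"
      by (simp add: suminf_diff that)
    also have "\<bar>\<dots>\<bar> \<le> (\<Sum>j. mass j * r)"
      using norm_suminf_le[of "\<lambda>j. p j - p' j" "\<lambda>j. mass j * r"] that
      by (simp add: summable_mult2 summable_mass)
    also have "\<dots> = suminf mass * r"
      by (simp add: suminf_mult2[symmetric] summable_mass)
    finally show ?thesis .
  qed
  show "\<bar>obj_a a b - obj_a c d\<bar> \<le> suminf mass * r"
    unfolding obj_a_def
  proof (intro sums summable_obj)
    fix j
    have "weight j * (- ((-1) ^ j) * hinge j a b) - weight j * (- ((-1) ^ j) * hinge j c d)
        = weight j * (- ((-1) ^ j) * (hinge j a b - hinge j c d))"
      by (simp add: algebra_simps)
    then show "\<bar>weight j * (- ((-1) ^ j) * hinge j a b) - weight j * (- ((-1) ^ j) * hinge j c d)\<bar>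
        \<le> mass j * r"
      using est(1)[of j] weight_pos[of j] by (simp add: abs_mult power_abs)
  qed
  have "\<bar>(\<Sum>j. weight j * (slope j * hinge j a b)) - (\<Sum>j. weight j * (slope j * hinge j c d))\<bar>
      \<le> suminf mass * r"
  proof (intro sums summable_obj)
    fix j
    have "weight j * (slope j * hinge j a b) - weight j * (slope j * hinge j c d)
        = weight j * (slope j * (hinge j a b - hinge j c d))"
      by (simp add: algebra_simps)
    then show "\<bar>weight j * (slope j * hinge j a b) - weight j * (slope j * hinge j c d)\<bar>
        \<le> mass j * r"
      using est(2)[of j] weight_pos[of j] slope_nonneg[of j] by (simp add: abs_mult)
  qed
  then show "\<bar>obj_b a b - obj_b c d\<bar> \<le> suminf mass * r"
    by (simp add: obj_b_def)
qed

section \<open>The direction of the gradient\<close>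

text \<open>
  At these heights the \<open>k\<close>-th hinge is at least a fixed fraction of \<open>slope k * b\<close>. The point lies below the
  line of every earlier hinge of the other parity, and the earlier ones of the same parity push in the
  same direction. A later hinge pushes with force at most \<open>2 * weight j * slope j * b\<close>, a geometric
  sequence with ratio \<open>1 / 1024\<close> whose sum does not outweigh the \<open>k\<close>-th push.
\<close>

lemma gradient_window:
  assumes k: "0 < k" and b: "2 / 32 ^ k \<le> b" "b \<le> 16 / 32 ^ k"
    and a: "(-1) ^ k * a \<le> 1 / 4" "\<bar>a\<bar> \<le> 1 + b"
  shows "(-1) ^ k * obj_a a b < 0"
proof -
  define \<sigma> :: real where "\<sigma> = (-1) ^ k"
  define p where "p j = \<sigma> * (weight j * (- ((-1) ^ j) * hinge j a b))" for j
  have \<sigma>: "\<sigma> * \<sigma> = 1"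
    by (simp add: \<sigma>_def flip: power_add)
  have b0: "0 < b"
    using b(1) by (rule less_le_trans[rotated]) simp
  have p_le: "p j \<le> weight j * hinge j a b" for j
  proof (cases "(-1) ^ j = \<sigma>")
    case True
    then have "p j = - (\<sigma> * \<sigma>) * (weight j * hinge j a b)"
      by (simp add: p_def)
    then show ?thesis
      using weight_pos[of j] hinge_nonneg[of j a b] \<sigma> by simp
  next
    case False
    then have "(-1) ^ j = - \<sigma>"
      unfolding \<sigma>_def by (cases k rule: alternating_cases; cases j rule: alternating_cases) auto
    then have "p j = (\<sigma> * \<sigma>) * (weight j * hinge j a b)"
      by (simp add: p_def)
    then show ?thesis
      using \<sigma> by simp
  qed
  have early: "p j \<le> 0" if "j < k" for j
  proof (cases "(-1) ^ j = \<sigma>")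
    case True
    then have "p j = - (\<sigma> * \<sigma>) * (weight j * hinge j a b)"
      by (simp add: p_def)
    then show ?thesis
      using weight_pos[of j] hinge_nonneg[of j a b] \<sigma> by simp
  next
    case False
    then have opp: "(-1) ^ j = - \<sigma>"
      unfolding \<sigma>_def by (cases k rule: alternating_cases; cases j rule: alternating_cases) auto
    have "slope j \<le> 32 ^ (k - 1)"
      using that power_increasing[of j "k - 1" "32::real"] by (auto simp: slope_def)
    then have "slope j * b \<le> 32 ^ (k - 1) * (16 / 32 ^ k)"
      using b b0 by (intro mult_mono) auto
    also have "\<dots> = 1 / 2"
      using k by (cases k) auto
    finally have "hinge j a b = 0"
      using a(1) opp by (simp add: hinge_def \<sigma>_def)
    then show ?thesis
      by (simp add: p_def)
  qed
  have at_k: "p k \<le> - (3 / 8) * ((1 / 32) ^ (2 * k) * b)"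
  proof -
    have "2 \<le> slope k * b"
      using b(1) k by (simp add: slope_def field_simps)
    then have "3 / 8 * (slope k * b) \<le> hinge k a b"
      unfolding hinge_def using a(1) by linarith
    then have "weight k * (3 / 8 * (slope k * b)) \<le> weight k * hinge k a b"
      using weight_pos[of k] by (intro mult_left_mono) auto
    moreover have "p k = - (\<sigma> * \<sigma>) * (weight k * hinge k a b)"
      by (simp add: p_def \<sigma>_def)
    ultimately show ?thesis
      using \<sigma> weight_slope(1)[OF k, symmetric] by (simp add: mult.assoc mult.left_commute)
  qed
  have late: "p j \<le> 2 * ((1 / 32) ^ (2 * j) * b)" if "k < j" for j
  proof -
    have "1 \<le> slope j"
      using that by (simp add: slope_def)
    then have "1 * b \<le> slope j * b"
      using b0 by (intro mult_right_mono) auto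
    moreover have "hinge j a b \<le> slope j * b + b"
      using a(2) b0 slope_nonneg[of j] by (cases j rule: alternating_cases) (auto simp: hinge_def)
    ultimately have "hinge j a b \<le> 2 * (slope j * b)"
      by simp
    then have "weight j * hinge j a b \<le> weight j * (2 * (slope j * b))"
      using weight_pos[of j] by (intro mult_left_mono) auto
    then show ?thesis
      using p_le[of j] weight_slope(1)[of j, symmetric] that by (simp add: mult.assoc mult.left_commute)
  qed
  \<comment> \<open>The summand at \<open>i = 0\<close> corrects the geometric bound \<open>2\<close> to \<open>- 3 / 8\<close>, the push of hinge \<open>k\<close>.\<close>
  define e :: "nat \<Rightarrow> real" where "e i = 2 * (1 / 1024) ^ i + (if i = 0 then - (19 / 8) else 0)" for i
  have shifted: "p (i + k) \<le> e i * ((1 / 32) ^ (2 * k) * b)" for i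
  proof (cases "i = 0")
    case False
    have "(1 / 32 :: real) ^ (2 * (i + k)) = (1 / 1024) ^ i * (1 / 32) ^ (2 * k)"
      by (simp add: power_add power_mult power2_eq_square)
    then show ?thesis
      using late[of "i + k"] False by (simp add: e_def mult.assoc)
  qed (use at_k in \<open>simp add: e_def\<close>)
  have "e sums (2 * (1 / (1 - 1 / 1024)) + - (19 / 8))"
    unfolding e_def by (intro sums_add sums_mult geometric_sums sums_single) simp
  then have e: "(\<lambda>i. e i * ((1 / 32) ^ (2 * k) * b)) sums
      ((2 * (1 / (1 - 1 / 1024)) + - (19 / 8)) * ((1 / 32) ^ (2 * k) * b))"
    by (rule sums_mult2)
  have p: "summable p" "suminf p = \<sigma> * obj_a a b"
    unfolding p_def obj_a_def
    by (intro summable_mult summable_obj suminf_mult)+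
  have "suminf p = (\<Sum>i. p (i + k)) + (\<Sum>j<k. p j)"
    by (rule suminf_split_initial_segment[OF p(1)])
  also have "(\<Sum>j<k. p j) \<le> 0"
    using early by (intro sum_nonpos) auto
  also have "(\<Sum>i. p (i + k)) \<le> (2 * (1 / (1 - 1 / 1024)) + - (19 / 8)) * ((1 / 32) ^ (2 * k) * b)"
    using shifted e p(1) by (intro sums_le[OF _ summable_sums e]) (auto simp: summable_iff_shift)
  also have "\<dots> < 0"
    using b0 by (simp add: mult_neg_pos)
  finally show ?thesis
    using p(2) by (simp add: \<sigma>_def)
qed

text \<open>
  Hinge \<open>0\<close> vanishes here and the others have slope at least \<open>1\<close>, so each contributes at least as much
  to the vertical as to the horizontal derivative; the term \<open>b / 2\<close> makes the inequality strict.
\<close>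

lemma gradient_mostly_vertical:
  assumes "-1 \<le> a"
  shows "\<bar>obj_a a b\<bar> < obj_b a b"
proof -
  have term_le: "\<bar>weight j * (- ((-1) ^ j) * hinge j a b)\<bar> \<le> weight j * (slope j * hinge j a b)" for j
  proof (cases "j = 0")
    case True
    then show ?thesis
      using assms by (simp add: hinge_def slope_def)
  next
    case False
    then have "1 * hinge j a b \<le> slope j * hinge j a b"
      using hinge_nonneg[of j a b] by (intro mult_right_mono) (auto simp: slope_def)
    then show ?thesis
      using weight_pos[of j] hinge_nonneg[of j a b] by (simp add: abs_mult power_abs)
  qed
  have "\<bar>obj_a a b\<bar> \<le> (\<Sum>j. weight j * (slope j * hinge j a b))"
    using norm_suminf_le[of "\<lambda>j. weight j * (- ((-1) ^ j) * hinge j a b)"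
        "\<lambda>j. weight j * (slope j * hinge j a b)"] term_le summable_obj(3)[of a b]
    unfolding obj_a_def by (simp only: real_norm_def)
  then show ?thesis
    by (simp add: obj_b_def)
qed

text \<open>
  The sum of the two derivatives receives \<open>1 / 2\<close> from the linear term, \<open>-1\<close> from hinge \<open>0\<close>, and at most
  \<open>1 / 31\<close> from all the other hinges together.
\<close>

lemma gradient_at_start: "obj_b (-2) 1 < - obj_a (-2) 1"
proof -
  define p where "p j = weight j * (slope j * hinge j (-2) 1)
      + weight j * (- ((-1) ^ j) * hinge j (-2) 1)" for j
  \<comment> \<open>Hinge \<open>0\<close> contributes \<open>-1 = 1 - 2\<close>; a later one contributes at most \<open>weight j * (slope j)\<^sup>2\<close>.\<close>
  define e :: "nat \<Rightarrow> real" where "e j = (1 / 32) ^ j + (if j = 0 then - 2 else 0)" for j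
  have "p j \<le> e j" for j
  proof (cases "j = 0")
    case True
    then show ?thesis
      by (simp add: p_def e_def weight_def slope_def hinge_def)
  next
    case False
    then have s: "32 \<le> slope j"
      using power_increasing[of 1 j "32::real"] by (auto simp: slope_def)
    have "(slope j - (-1) ^ j) * hinge j (-2) 1 \<le> (slope j)\<^sup>2"
      using s by (cases j rule: alternating_cases) (auto simp: hinge_def algebra_simps power2_eq_square)
    then have "weight j * ((slope j - (-1) ^ j) * hinge j (-2) 1) \<le> weight j * (slope j)\<^sup>2"
      using weight_pos[of j] by (intro mult_left_mono) auto
    then show ?thesis
      using weight_slope(2)[of j] False by (simp add: p_def e_def algebra_simps)
  qed
  moreover have "p sums ((obj_b (-2) 1 - 1 / 2) + obj_a (-2) 1)"
    unfolding p_def obj_a_def obj_b_def add_diff_cancel_left'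
    by (intro sums_add summable_sums summable_obj)
  moreover have "e sums (1 / (1 - 1 / 32) + - 2)"
    unfolding e_def by (intro sums_add geometric_sums sums_single) simp
  ultimately have "(obj_b (-2) 1 - 1 / 2) + obj_a (-2) 1 \<le> 1 / (1 - 1 / 32) + - 2"
    by (rule sums_le)
  then show ?thesis
    by simp
qed

section \<open>Linear minimization over the trapezoid\<close>

definition trapezoid :: "(real \<times> real) set"
  where "trapezoid = {(a, b). 0 \<le> b \<and> b \<le> 1 \<and> \<bar>a\<bar> \<le> 1 + b}"

lemma convex_trapezoid: "convex trapezoid"
proof -
  have eq: "trapezoid = {p. inner (0, -1) p \<le> 0} \<inter> {p. inner (0, 1) p \<le> 1}
      \<inter> {p. inner (1, -1) p \<le> 1} \<inter> {p. inner (-1, -1) p \<le> 1}"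
    by (auto simp: trapezoid_def)
  show ?thesis
    unfolding eq by (intro convex_Int convex_halfspace_le)
qed

lemma compact_trapezoid: "compact trapezoid"
proof -
  have "closed trapezoid"
    unfolding trapezoid_def case_prod_unfold
    by (intro closed_Collect_conj closed_Collect_le continuous_intros)
  moreover have "trapezoid \<subseteq> cbox (-2, 0) (2, 1)"
    by (auto simp: trapezoid_def cbox_Pair_eq)
  ultimately show ?thesis
    by (meson bounded_cbox bounded_subset compact_eq_bounded_closed)
qed

text \<open>
  Rising by \<open>d\<close> costs \<open>d * q\<close> and widens the trapezoid by only \<open>d\<close> on each side, a gain of at most
  \<open>d * \<bar>p\<bar>\<close>. When \<open>- p\<close> is the larger number instead,
  the same comparison makes the top right corner optimal.
\<close>

lemma trapezoid_minimizer_base: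
  assumes pq: "\<bar>p\<bar> < q" and cd: "(c, d) \<in> trapezoid"
    and min: "\<And>a b. (a, b) \<in> trapezoid \<Longrightarrow> c * p + d * q \<le> a * p + b * q"
  shows "d = 0" and "\<bar>c\<bar> \<le> 1" and "\<lbrakk>\<sigma> = 1 \<or> \<sigma> = -1; \<sigma> * p < 0\<rbrakk> \<Longrightarrow> c = \<sigma>"
proof -
  have m: "c * p + d * q \<le> p" "c * p + d * q \<le> - p"
    using min[of 1 0] min[of "-1" 0] by (auto simp: trapezoid_def)
  have "- ((1 + d) * \<bar>p\<bar>) \<le> - (\<bar>c\<bar> * \<bar>p\<bar>)"
    using cd by (auto simp: trapezoid_def intro!: mult_right_mono)
  also have "\<dots> \<le> c * p"
    by (simp flip: abs_mult)
  finally have "- \<bar>p\<bar> - d * \<bar>p\<bar> \<le> c * p"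
    by (simp add: distrib_right)
  then have "d * (q - \<bar>p\<bar>) \<le> 0"
    unfolding right_diff_distrib using m by linarith
  then show d: "d = 0"
    using pq cd by (auto simp: trapezoid_def mult_le_0_iff)
  then show c: "\<bar>c\<bar> \<le> 1"
    using cd by (simp add: trapezoid_def)
  assume \<sigma>: "\<sigma> = 1 \<or> \<sigma> = -1" "\<sigma> * p < 0"
  then show "c = \<sigma>"
  proof (elim disjE)
    assume "\<sigma> = 1"
    then have "p < 0" "(1 - c) * p \<ge> 0"
      using \<sigma>(2) m(1) d by (auto simp: algebra_simps)
    then show ?thesis
      using c \<open>\<sigma> = 1\<close> by (auto simp: zero_le_mult_iff)
  next
    assume "\<sigma> = -1"
    then have "0 < p" "(1 + c) * p \<le> 0"
      using \<sigma>(2) m(2) d by (auto simp: algebra_simps)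
    then show ?thesis
      using c \<open>\<sigma> = -1\<close> by (auto simp: mult_le_0_iff)
  qed
qed

lemma trapezoid_minimizer_corner:
  assumes pq: "\<bar>q\<bar> < - p" and cd: "(c, d) \<in> trapezoid"
    and min: "\<And>a b. (a, b) \<in> trapezoid \<Longrightarrow> c * p + d * q \<le> a * p + b * q"
  shows "c = 2" and "d = 1"
proof -
  have m: "c * p + d * q \<le> 2 * p + q"
    using min[of 2 1] by (simp add: trapezoid_def)
  have "(1 + d) * p \<le> c * p"
    using cd pq by (intro mult_right_mono_neg) (auto simp: trapezoid_def)
  then have "(1 - d) * (- p - q) \<le> 0"
    using m by (simp add: algebra_simps)
  then show d: "d = 1"
    using pq cd by (auto simp: trapezoid_def mult_le_0_iff)
  then have "(2 - c) * p \<ge> 0"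
    using m by (simp add: algebra_simps)
  then show "c = 2"
    using pq cd d by (auto simp: trapezoid_def zero_le_mult_iff)
qed

section \<open>Divergence of the iterates\<close>

text \<open>
  While \<open>c t = \<sigma>\<close> both \<open>1 - \<sigma> * X t\<close> and \<open>Y t\<close> are multiplied by \<open>1 - \<gamma> t\<close>, so their ratio is constant. The step
  sizes enter only through two consequences of their bounds: \<open>Y\<close> tends to \<open>0\<close>, and it shrinks by at most a
  factor \<open>3\<close> per step. Hence \<open>Y\<close> cannot leap over a window of ratio \<open>8\<close>: it enters at a height
  above a third of the upper end and is halved before it leaves at the lower end.
\<close>

lemma pushed_averages_oscillate:
  fixes X Y c \<gamma> :: "nat \<Rightarrow> real"
  assumes \<gamma>: "\<And>t. 1 / (real t + 1) \<le> \<gamma> t" "\<And>t. \<gamma> t \<le> 2 / (real t + 2)"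
    and Y1: "Y 1 = 1" and Y: "\<And>t. 1 \<le> t \<Longrightarrow> Y (Suc t) = (1 - \<gamma> t) * Y t"
    and X: "\<And>t. 1 \<le> t \<Longrightarrow> X (Suc t) = (1 - \<gamma> t) * X t + \<gamma> t * c t"
    and push: "\<And>t k. \<lbrakk>1 \<le> t; 0 < k; 2 / 32 ^ k \<le> Y t; Y t \<le> 16 / 32 ^ k; (-1) ^ k * X t \<le> 1 / 4\<rbrakk>
      \<Longrightarrow> c t = (-1) ^ k"
  shows "\<not> convergent X"
proof
  assume "convergent X"
  then obtain \<xi> where \<xi>: "X \<longlonglongrightarrow> \<xi>"
    by (auto simp: convergent_def)
  have ratio: "1 / 3 \<le> 1 - \<gamma> t" "1 - \<gamma> t \<le> real t / (real t + 1)" if "1 \<le> t" for t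
  proof -
    have "2 / (real t + 2) \<le> 2 / 3"
      using that by (intro divide_left_mono) auto
    then show "1 / 3 \<le> 1 - \<gamma> t"
      using \<gamma>(2)[of t] by linarith
    have "1 - 1 / (real t + 1) = real t / (real t + 1)"
      by (simp add: field_simps)
    then show "1 - \<gamma> t \<le> real t / (real t + 1)"
      using \<gamma>(1)[of t] by linarith
  qed
  have Y_bounds: "0 < Y t \<and> Y t \<le> 1 / real t" if "1 \<le> t" for t
    using that
  proof (induction t rule: dec_induct)
    case (step t)
    have "(1 - \<gamma> t) * Y t \<le> real t / (real t + 1) * (1 / real t)"
      using step ratio[of t] by (intro mult_mono) auto
    moreover have "0 < (1 - \<gamma> t) * Y t"
      using step ratio[of t] by (intro mult_pos_pos) auto
    ultimately show ?case
      using step Y[of t] by (simp add: add.commute)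
  qed (simp add: Y1[unfolded One_nat_def])
  have Y_lim: "Y \<longlonglongrightarrow> 0"
  proof (rule tendsto_sandwich[OF _ _ tendsto_const lim_1_over_n])
    show "eventually (\<lambda>t. 0 \<le> Y t) sequentially"
      by (rule eventually_sequentiallyI[of 1]) (use Y_bounds less_imp_le in blast)
    show "eventually (\<lambda>t. Y t \<le> 1 / real t) sequentially"
      by (rule eventually_sequentiallyI[of 1]) (use Y_bounds in blast)
  qed
  have Y_small: "\<exists>t\<ge>N. Y t \<le> e" if "0 < e" for e N
  proof -
    have "eventually (\<lambda>t. Y t < e \<and> N \<le> t) sequentially"
      using order_tendstoD(2)[OF Y_lim that] eventually_ge_at_top by (rule eventually_conj)
    then show ?thesis
      by (auto simp: eventually_sequentially intro: less_imp_le)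
  qed
  have "eventually (\<lambda>t. \<bar>X t - \<xi>\<bar> < 1 / 8 \<and> 1 \<le> t) sequentially"
    using tendstoD[OF \<xi>, of "1/8"] eventually_ge_at_top[of 1]
    by (auto simp: dist_real_def intro: eventually_conj)
  then obtain N where N: "\<And>t. N \<le> t \<Longrightarrow> \<bar>X t - \<xi>\<bar> < 1 / 8" "1 \<le> N"
    by (auto simp: eventually_sequentially)
  \<comment> \<open>The parity of \<open>k\<close> selects an end of the base at distance at least \<open>1\<close> from the limit.\<close>
  obtain k where k: "0 < k" "(-1) ^ k * \<xi> \<le> 0" "16 / 32 ^ k < Y N"
  proof -
    obtain m where m: "(1 / 32) ^ m < Y N / 16"
      using real_arch_pow_inv[of "Y N / 16" "1 / 32"] Y_bounds[OF N(2)] by auto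
    have small: "16 / 32 ^ k < Y N" if "m \<le> k" for k
    proof -
      have "(1 / 32 :: real) ^ k \<le> (1 / 32) ^ m"
        using that by (intro power_decreasing) auto
      then show ?thesis
        using m by (simp add: power_divide)
    qed
    show ?thesis
    proof (cases "\<xi> \<le> 0")
      case True
      then show ?thesis
        by (intro that[of "2 * m + 2"] small) auto
    next
      case False
      then show ?thesis
        by (intro that[of "2 * m + 1"] small) auto
    qed
  qed
  define \<sigma> :: real where "\<sigma> = (-1) ^ k"
  have \<sigma>: "\<sigma> * \<sigma> = 1"
    by (simp add: \<sigma>_def flip: power_add)
  have near: "\<bar>\<sigma> * X t - \<sigma> * \<xi>\<bar> < 1 / 8" if "N \<le> t" for t
  proof -
    have "\<bar>\<sigma> * X t - \<sigma> * \<xi>\<bar> = \<bar>\<sigma>\<bar> * \<bar>X t - \<xi>\<bar>"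
      by (simp flip: abs_mult add: algebra_simps)
    then show ?thesis
      using N(1)[OF that] by (simp add: \<sigma>_def power_abs)
  qed
  \<comment> \<open>\<open>T\<close> is the time of entry into the window, \<open>S\<close> the first time after it at which the height is halved.\<close>
  define T where "T = (LEAST t. N \<le> t \<and> Y t \<le> 16 / 32 ^ k)"
  have "\<exists>t. N \<le> t \<and> Y t \<le> 16 / 32 ^ k"
    using Y_small[of "16 / 32 ^ k" N] by auto
  then have T: "N \<le> T" "Y T \<le> 16 / 32 ^ k"
    unfolding T_def by (metis (mono_tags, lifting) LeastI)+
  then have "N < T"
    using k(3) by (cases "N = T") auto
  have T_lower: "16 / 32 ^ k / 3 < Y T"
  proof -
    obtain s where s: "T = Suc s" "N \<le> s"
      using \<open>N < T\<close> by (cases T) auto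
    have "\<not> Y s \<le> 16 / 32 ^ k"
      using not_less_Least[of s "\<lambda>t. N \<le> t \<and> Y t \<le> 16 / 32 ^ k"] s by (auto simp: T_def[symmetric])
    then have "1 / 3 * (16 / 32 ^ k) < 1 / 3 * Y s"
      by simp
    also have "\<dots> \<le> (1 - \<gamma> s) * Y s"
      using ratio[of s] Y_bounds[of s] N s by (intro mult_right_mono) auto
    finally show ?thesis
      using Y[of s] s N by simp
  qed
  have T1: "1 \<le> T"
    using N T by simp
  define S where "S = (LEAST t. T \<le> t \<and> Y t \<le> Y T / 2)"
  have "\<exists>t. T \<le> t \<and> Y t \<le> Y T / 2"
    using Y_small[of "Y T / 2" T] Y_bounds[OF T1] by auto
  then have S: "T \<le> S" "Y S \<le> Y T / 2"
    unfolding S_def by (metis (mono_tags, lifting) LeastI)+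
  have before_S: "Y T / 2 < Y t" if "T \<le> t" "t < S" for t
    using not_less_Least[OF that(2)[unfolded S_def]] that(1) by linarith
  have "t \<le> S \<Longrightarrow> Y t \<le> Y T \<and> (1 - \<sigma> * X t) * Y T = (1 - \<sigma> * X T) * Y t" if "T \<le> t" for t
    using that
  proof (induction t rule: dec_induct)
    case (step t)
    have t: "1 \<le> t" "N \<le> t"
      using step T1 T by auto
    have IH: "Y t \<le> Y T" "(1 - \<sigma> * X t) * Y T = (1 - \<sigma> * X T) * Y t"
      using step by auto
    have "2 / 32 ^ k \<le> Y t"
    proof -
      define w :: real where "w = 1 / 32 ^ k"
      have w: "0 < w" "2 / 32 ^ k = 2 * w" "16 / 32 ^ k / 3 = 16 / 3 * w"
        by (simp_all add: w_def)
      show ?thesis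
        using before_S[OF step(1) Suc_le_lessD[OF step(4)]] T_lower w(1) unfolding w(2,3)
        by linarith
    qed
    moreover have "Y t \<le> 16 / 32 ^ k"
      using IH(1) T by simp
    moreover have "(-1) ^ k * X t \<le> 1 / 4"
      using near[OF t(2)] k(2) unfolding \<sigma>_def by linarith
    ultimately have "c t = \<sigma>"
      unfolding \<sigma>_def using push t k(1) by blast
    then have "1 - \<sigma> * X (Suc t) = (1 - \<gamma> t * (\<sigma> * \<sigma>)) - (1 - \<gamma> t) * (\<sigma> * X t)"
      unfolding X[OF t(1)] by (simp add: algebra_simps)
    then have "1 - \<sigma> * X (Suc t) = (1 - \<gamma> t) * (1 - \<sigma> * X t)"
      using \<sigma> by (simp add: algebra_simps)
    then have "(1 - \<sigma> * X (Suc t)) * Y T = (1 - \<gamma> t) * ((1 - \<sigma> * X t) * Y T)"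
      by simp
    also have "\<dots> = (1 - \<sigma> * X T) * Y (Suc t)"
      unfolding IH(2) using Y[OF t(1)] by simp
    finally have "(1 - \<sigma> * X (Suc t)) * Y T = (1 - \<sigma> * X T) * Y (Suc t)" .
    moreover have "Y (Suc t) \<le> 1 * Y t"
      unfolding Y[OF t(1)] using Y_bounds[OF t(1)] \<gamma>(1)[of t]
      by (intro mult_right_mono) (auto intro: order_trans[rotated])
    ultimately show ?case
      using IH(1) by simp
  qed simp
  then have "(1 - \<sigma> * X S) * Y T = (1 - \<sigma> * X T) * Y S"
    using S by blast
  also have "\<dots> \<le> (1 - \<sigma> * X T) * (Y T / 2)"
  proof (rule mult_left_mono[OF S(2)])
    show "0 \<le> 1 - \<sigma> * X T"
      using near[OF T(1)] k(2) unfolding \<sigma>_def by linarith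
  qed
  finally have "(1 - \<sigma> * X S) * Y T \<le> (1 - \<sigma> * X T) / 2 * Y T"
    by simp
  then have halved: "1 - \<sigma> * X S \<le> (1 - \<sigma> * X T) / 2"
    by (rule mult_right_le_imp_le) (use Y_bounds[OF T1] in simp)
  have "\<sigma> * \<xi> \<le> 0"
    using k(2) by (simp only: \<sigma>_def)
  then show False
    using halved near[OF T(1)] near[OF order_trans[OF T(1) S(1)]] by argo
qed

text \<open>
  After the first step the iterates are averages of \<open>(2, 1)\<close> and points of the base, hence stay in the
  region \<open>a \<ge> -1\<close> where the oracle answers in the base; this closes the induction.
\<close>

lemma frank_wolfe_on_trapezoid:
  assumes \<gamma>: "\<And>t. 1 / (real t + 1) \<le> \<gamma> t" "\<And>t. \<gamma> t \<le> 2 / (real t + 2)" "\<gamma> 0 = 1"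
    and start: "X 0 = -2" "Y 0 = 1"
    and v: "\<And>t. (c t, d t) \<in> trapezoid"
    and min: "\<And>t a b. (a, b) \<in> trapezoid \<Longrightarrow>
      c t * obj_a (X t) (Y t) + d t * obj_b (X t) (Y t) \<le> a * obj_a (X t) (Y t) + b * obj_b (X t) (Y t)"
    and X: "\<And>t. X (Suc t) = (1 - \<gamma> t) * X t + \<gamma> t * c t"
    and Y: "\<And>t. Y (Suc t) = (1 - \<gamma> t) * Y t + \<gamma> t * d t"
  shows "\<not> convergent X"
proof -
  have "0 < obj_b (-2) 1"
  proof -
    have "0 \<le> (\<Sum>j. weight j * (slope j * hinge j (-2) 1))"
      by (intro suminf_nonneg summable_obj mult_nonneg_nonneg slope_nonneg hinge_nonneg
          less_imp_le[OF weight_pos])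
    then show ?thesis
      by (simp add: obj_b_def)
  qed
  then have corner: "c 0 = 2" "d 0 = 1"
    using trapezoid_minimizer_corner[OF _ v min] gradient_at_start start by simp_all
  have step1: "X 1 = 2" "Y 1 = 1"
    using X[of 0] Y[of 0] corner \<gamma>(3) by simp_all
  have \<gamma>01: "0 \<le> \<gamma> t" "\<gamma> t \<le> 1" for t
  proof -
    have "0 \<le> 1 / (real t + 1)" "2 / (real t + 2) \<le> 1"
      by auto
    then show "0 \<le> \<gamma> t" "\<gamma> t \<le> 1"
      using \<gamma>(1,2)[of t] by linarith+
  qed
  have base: "d t = 0" "\<bar>c t\<bar> \<le> 1"
    "\<lbrakk>\<sigma> = 1 \<or> \<sigma> = -1; \<sigma> * obj_a (X t) (Y t) < 0\<rbrakk> \<Longrightarrow> c t = \<sigma>"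
    if "-1 \<le> X t" for t \<sigma>
    using trapezoid_minimizer_base[OF gradient_mostly_vertical[OF that] v min] by blast+
  have right: "-1 \<le> X t" if "1 \<le> t" for t
    using that
  proof (induction t rule: dec_induct)
    case (step t)
    have "(1 - \<gamma> t) * (-1) + \<gamma> t * (-1) \<le> (1 - \<gamma> t) * X t + \<gamma> t * c t"
      using step base(2)[of t] \<gamma>01[of t] by (intro add_mono mult_left_mono) auto
    then show ?case
      by (simp add: X)
  qed (use step1 in simp)
  have inside: "(X t, Y t) \<in> trapezoid" for t
  proof (induction t)
    case (Suc t)
    have "(1 - \<gamma> t) *\<^sub>R (X t, Y t) + \<gamma> t *\<^sub>R (c t, d t) \<in> trapezoid"
      using Suc v \<gamma>01[of t] by (intro convexD[OF convex_trapezoid]) auto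
    then show ?case
      by (simp add: X Y)
  qed (simp add: start trapezoid_def)
  show ?thesis
  proof (rule pushed_averages_oscillate[where \<gamma> = \<gamma> and Y = Y and c = c])
    show "1 / (real t + 1) \<le> \<gamma> t" "\<gamma> t \<le> 2 / (real t + 2)" for t
      by (rule \<gamma>)+
    show "Y 1 = 1"
      by (rule step1)
    show "X (Suc t) = (1 - \<gamma> t) * X t + \<gamma> t * c t" for t
      by (rule X)
    show "Y (Suc t) = (1 - \<gamma> t) * Y t" if "1 \<le> t" for t
      using Y[of t] base(1)[OF right[OF that]] by simp
    show "c t = (-1) ^ k"
      if "1 \<le> t" "0 < k" "2 / 32 ^ k \<le> Y t" "Y t \<le> 16 / 32 ^ k" "(-1) ^ k * X t \<le> 1 / 4" for t k
    proof (rule base(3))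
      show "-1 \<le> X t"
        by (rule right) (fact that)
      show "(-1::real) ^ k = 1 \<or> (-1::real) ^ k = -1"
        by (cases k rule: alternating_cases) auto
      show "(-1) ^ k * obj_a (X t) (Y t) < 0"
        using that inside[of t] by (intro gradient_window) (auto simp: trapezoid_def)
    qed
  qed
qed

theorem mainTheorem4:
  shows "\<exists>(n::nat) (L::real) (C::fsvec set) (D::fsvec set) (f::fsvec \<Rightarrow> real) (x0::fsvec).
    L > 0 \<and>
    C \<subseteq> Rn n \<and> C \<noteq> {} \<and> compact C \<and> convex C \<and>
    openin (top_of_set (Rn n)) D \<and> convex D \<and> C \<subseteq> D \<and>
    convex_on D f \<and>
    (\<forall>x\<in>D. \<exists>g. has_gradient n f x g) \<and> lipschitz_on L D (grad n f) \<and>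
    x0 \<in> C \<and>
    (\<forall>(\<gamma>::nat \<Rightarrow> real) (x::nat \<Rightarrow> fsvec).
      ((\<forall>t. \<gamma> t = 1 / (real t + 1)) \<or> (\<forall>t. \<gamma> t = 2 / (real t + 2))) \<longrightarrow>
      frank_wolfe n C f \<gamma> x0 x \<longrightarrow> \<not> convergent x)"
proof -
  define C where "C = (\<lambda>p. plane (fst p) (snd p)) ` trapezoid"
  define f where "f z = obj (coord z 0) (coord z 1)" for z
  define g where "g z = plane (obj_a (coord z 0) (coord z 1)) (obj_b (coord z 0) (coord z 1))" for z
  define W where "W = suminf mass"
  have C_iff: "z \<in> C \<longleftrightarrow> z \<in> Rn 2 \<and> (coord z 0, coord z 1) \<in> trapezoid" for z
  proof
    show "z \<in> C \<Longrightarrow> z \<in> Rn 2 \<and> (coord z 0, coord z 1) \<in> trapezoid"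
      by (auto simp: C_def coord_plane plane_in_Rn)
  next
    assume "z \<in> Rn 2 \<and> (coord z 0, coord z 1) \<in> trapezoid"
    then show "z \<in> C"
      unfolding C_def using plane_coord[of z]
      by (intro image_eqI[of _ _ "(coord z 0, coord z 1)"]) auto
  qed
  have coord_diff: "\<bar>coord x i - coord y i\<bar> \<le> norm (x - y)" for x y i
    using abs_coord_le_norm[of "x - y" i] by simp
  have g_Rn: "g z \<in> Rn 2" for z
    by (simp add: g_def plane_in_Rn)
  have bounds: "f x + inner (y - x) (g x) \<le> f y"
    "f y \<le> f x + inner (y - x) (g x) + W * (norm (y - x))\<^sup>2" for x y
    unfolding f_def g_def inner_plane W_def
    using obj_bounds(1) obj_bounds(2)[OF coord_diff coord_diff] by simp_all
  note smooth = gradient_from_quadratic_bounds[of 2 g f, OF g_Rn bounds]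
  have grad: "grad 2 f z = g z" if "z \<in> Rn 2" for z
    using grad_eq smooth(2) that by blast
  have lipschitz: "lipschitz_on (2 * W) (Rn 2) (grad 2 f)"
  proof (rule lipschitz_onI)
    fix y z assume yz: "y \<in> Rn 2" "z \<in> Rn 2"
    have "norm (g y - g z) \<le> W * norm (y - z) + W * norm (y - z)"
      unfolding g_def plane_diff W_def
      by (rule order_trans[OF norm_plane_le])
        (intro add_mono gradient_lipschitz coord_diff)
    then show "dist (grad 2 f y) (grad 2 f z) \<le> 2 * W * dist y z"
      using yz by (simp add: grad dist_norm)
  qed (use suminf_mass_pos in \<open>simp add: W_def\<close>)
  have diverges: "\<not> convergent x"
    if \<gamma>: "(\<forall>t. \<gamma> t = 1 / (real t + 1)) \<or> (\<forall>t. \<gamma> t = 2 / (real t + 2))"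
      and fw: "frank_wolfe 2 C f \<gamma> (plane (-2) 1) x" for \<gamma> x
  proof
    assume "convergent x"
    then obtain l where "x \<longlonglongrightarrow> l"
      by (auto simp: convergent_def)
    then have "(\<lambda>t. coord (x t) 0) \<longlonglongrightarrow> coord l 0"
      by (rule bounded_linear.tendsto[OF bounded_linear_coord])
    moreover have "\<not> convergent (\<lambda>t. coord (x t) 0)"
    proof -
      have "\<forall>t. \<exists>v. is_arg_min (\<lambda>w. inner w (grad 2 f (x t))) (\<lambda>w. w \<in> C) v \<and>
          x (Suc t) = (1 - \<gamma> t) *\<^sub>R x t + \<gamma> t *\<^sub>R v"
        using fw unfolding frank_wolfe_def by blast
      then obtain v where vx: "\<forall>t. is_arg_min (\<lambda>w. inner w (grad 2 f (x t))) (\<lambda>w. w \<in> C) (v t) \<and>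
          x (Suc t) = (1 - \<gamma> t) *\<^sub>R x t + \<gamma> t *\<^sub>R v t"
        by (rule choice[THEN exE])
      then have v: "is_arg_min (\<lambda>w. inner w (grad 2 f (x t))) (\<lambda>w. w \<in> C) (v t)"
        and x: "x (Suc t) = (1 - \<gamma> t) *\<^sub>R x t + \<gamma> t *\<^sub>R v t" for t
        by blast+
      have vC: "v t \<in> C" for t
        using v[of t] by (simp add: is_arg_min_def)
      have x_Rn: "x t \<in> Rn 2" for t
      proof (induction t)
        case 0
        then show ?case
          using fw by (simp add: frank_wolfe_def plane_in_Rn)
      next
        case (Suc t)
        then show ?case
          unfolding x using vC C_iff subspace_Rn by (intro subspace_add subspace_scale) auto
      qed
      have "1 / (real t + 1) \<le> 2 / (real t + 2)" for t
        by (simp add: field_simps)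
      then have \<gamma>_range: "1 / (real t + 1) \<le> \<gamma> t" "\<gamma> t \<le> 2 / (real t + 2)" for t
        using \<gamma> by auto
      show ?thesis
      proof (rule frank_wolfe_on_trapezoid
            [where \<gamma> = \<gamma> and Y = "\<lambda>t. coord (x t) 1" and c = "\<lambda>t. coord (v t) 0" and d = "\<lambda>t. coord (v t) 1"])
        show "1 / (real t + 1) \<le> \<gamma> t" "\<gamma> t \<le> 2 / (real t + 2)" for t
          by (rule \<gamma>_range)+
        show "\<gamma> 0 = 1"
          using \<gamma> by auto
        show "coord (x 0) 0 = -2" "coord (x 0) 1 = 1"
          using fw by (simp_all add: frank_wolfe_def coord_plane)
        show "(coord (v t) 0, coord (v t) 1) \<in> trapezoid" for t
          using vC C_iff by blast
        fix t a b assume "(a, b) \<in> trapezoid"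
        then have "plane a b \<in> C"
          by (simp add: C_iff plane_in_Rn coord_plane)
        then have "inner (v t) (g (x t)) \<le> inner (plane a b) (g (x t))"
          using v[of t] x_Rn[of t] by (auto simp: is_arg_min_def grad not_less)
        then show "coord (v t) 0 * obj_a (coord (x t) 0) (coord (x t) 1)
            + coord (v t) 1 * obj_b (coord (x t) 0) (coord (x t) 1)
          \<le> a * obj_a (coord (x t) 0) (coord (x t) 1) + b * obj_b (coord (x t) 0) (coord (x t) 1)"
          by (simp add: g_def inner_plane coord_plane)
      qed (simp_all add: x)
    qed
    ultimately show False
      by (auto simp: convergent_def)
  qed
  have start: "plane (-2) 1 \<in> C"
    by (simp add: C_iff plane_in_Rn coord_plane trapezoid_def)
  have compact: "compact C"
    unfolding C_def
    by (intro compact_continuous_image compact_trapezoid linear_continuous_on bounded_linear_plane)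
  have convex: "convex C"
    unfolding C_def
    by (intro convex_linear_image convex_trapezoid bounded_linear.linear bounded_linear_plane)
  have subset: "C \<subseteq> Rn 2"
    using C_iff by blast
  have pos: "0 < 2 * W" and nonempty: "C \<noteq> {}"
    using suminf_mass_pos start by (auto simp: W_def)
  have gradients: "\<forall>x\<in>Rn 2. \<exists>g. has_gradient 2 f x g"
    using smooth(2) by blast
  have divergence: "\<forall>\<gamma> x. (\<forall>t. \<gamma> t = 1 / (real t + 1)) \<or> (\<forall>t. \<gamma> t = 2 / (real t + 2)) \<longrightarrow>
      frank_wolfe 2 C f \<gamma> (plane (-2) 1) x \<longrightarrow> \<not> convergent x"
    using diverges by blast
  show ?thesis
    by (rule exI[of _ 2], rule exI[of _ "2 * W"], rule exI[of _ C], rule exI[of _ "Rn 2"],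
        rule exI[of _ f], rule exI[of _ "plane (-2) 1"])
      (intro conjI pos nonempty start compact convex subset gradients divergence smooth(1)
        lipschitz openin_subtopology_self subspace_imp_convex subspace_Rn)
qed

end
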